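(* For every real $\alpha<1$ there exists a tile set $\tau$ such that $\tau$-tilings of the plane exist and every $\tau$-tiling is $\alpha$-aperiodic.
   Context: A tile set is a finite subset $\tau\subset C^4$ for a finite color set $C$; a $\tau$-tiling of the plane is a map $U\colon\mathbb{Z}^2\to\tau$ in which adjacent tiles have equal colors on their common side. A map $U\colon\mathbb{Z}^2\to\tau$ is $\alpha$-aperiodic if for every nonzero vector $T\in\mathbb{Z}^2$ there exists $N$ such that in every square of side at least $N$ the fraction of points $x$ with $U(x)\ne U(x+T)$ exceeds $\alpha$. *)

theory Defs
  imports Complex_Main "HOL-Library.Product_Plus"
begin

text \<open>A tile is a quadruple of colours (north, east, south, west); colours are natural
numbers, and a tile set is a finite set of such quadruples (so only finitely many colours occur).\<close>

type_synonym tile = "nat \<times> nat \<times> nat \<times> nat"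

definition north :: "tile \<Rightarrow> nat" where "north t = fst t"
definition east :: "tile \<Rightarrow> nat" where "east t = fst (snd t)"
definition south :: "tile \<Rightarrow> nat" where "south t = fst (snd (snd t))"
definition west :: "tile \<Rightarrow> nat" where "west t = snd (snd (snd t))"

definition tile_set :: "tile set \<Rightarrow> bool" where
  "tile_set \<tau> \<longleftrightarrow> finite \<tau>"

definition tiling :: "tile set \<Rightarrow> (int \<times> int \<Rightarrow> tile) \<Rightarrow> bool" where
  "tiling \<tau> U \<longleftrightarrow>
     (\<forall>x. U x \<in> \<tau>) \<and>
     (\<forall>i j. east (U (i, j)) = west (U (i + 1, j))) \<and>
     (\<forall>i j. north (U (i, j)) = south (U (i, j + 1)))"

definition square :: "int \<Rightarrow> int \<Rightarrow> nat \<Rightarrow> (int \<times> int) set" where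
  "square a b n = {a..<a + int n} \<times> {b..<b + int n}"

definition aperiodic :: "real \<Rightarrow> (int \<times> int \<Rightarrow> 'a) \<Rightarrow> bool" where
  "aperiodic \<alpha> U \<longleftrightarrow>
     (\<forall>T :: int \<times> int. T \<noteq> (0, 0) \<longrightarrow>
        (\<exists>N :: nat. \<forall>n \<ge> N. \<forall>a b.
           real (card {x \<in> square a b n. U x \<noteq> U (x + T)}) > \<alpha> * real (card (square a b n))))"

end

theory Submission
  imports Defs "HOL-Analysis.Kronecker_Approximation_Theorem" "HOL-Library.Countable"
begin

text \<open>As in the aperiodic tile sets of Kari and Culik, each row of tiles encodes real numbers as
  averages of bounded integer digits, and carries passed along the row force consecutive rows to
  follow an affine map. Here the state is a pair \<open>(x, y)\<close> with \<open>x \<in> [1, 6]\<close> moving by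
  \<open>x \<mapsto> 2x\<close> or \<open>x \<mapsto> x/3\<close> (an irrational rotation of the circle of positive reals modulo 6) and
  the skew product \<open>y \<mapsto> y + Mx mod 1\<close>; every tile of a row carries the index of the interval of
  length \<open>1/M\<close> containing \<open>y\<close>. Two rows at vertical distance \<open>b\<close> have equal indices only if
  \<open>M(x\<^sub>i + \<dots> + x\<^bsub>i+b-1\<^esub>)\<close> lies within \<open>1/M\<close> of an integer. If \<open>\<rho> = 2\<^sup>r/6\<^sup>q\<close> is slightly larger
  than 1, moving \<open>r\<close> rows up multiplies this number by \<open>\<rho>\<close> unless one of the \<open>x\<close>'s is close
  to 6, so a slow geometric sweep shows that this happens for a proportion \<open>O(1/M)\<close> of the rows,
  uniformly in \<open>b\<close>. Shifts with no vertical component are handled by overlaying the tile set with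
  its transpose.\<close>

subsection \<open>Return times of the multiplicative rotation\<close>

definition window :: "int \<Rightarrow> nat \<Rightarrow> int set" where
  "window B n = {B..<B + int n}"

lemma finite_window [simp]: "finite (window B n)"
  by (simp add: window_def)

lemma card_window [simp]: "card (window B n) = n"
  by (simp add: window_def)

lemma card_window_shift:
  "card {i \<in> window B n. P (i + s)} = card {i \<in> window (B + s) n. P i}"
  by (rule bij_betw_same_card[of "\<lambda>i. i + s"],
      rule bij_betwI[of _ _ _ "\<lambda>i. i - s"]) (auto simp: window_def)

text \<open>Only the first \<open>s\<close> points of the window are lost by the shift.\<close>

lemma card_window_le_shifted:
  "card {i \<in> window B n. P i} \<le> card {i \<in> window (B + int s) n. P i} + s"
proof -
  have "{i \<in> window B n. P i} \<subseteq> {i \<in> window (B + int s) n. P i} \<union> window B s"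
    by (auto simp: window_def)
  then have "card {i \<in> window B n. P i} \<le> card ({i \<in> window (B + int s) n. P i} \<union> window B s)"
    by (intro card_mono) auto
  also have "\<dots> \<le> card {i \<in> window (B + int s) n. P i} + card (window B s)"
    by (rule card_Un_le)
  finally show ?thesis by simp
qed

text \<open>Double counting over the pairs \<open>(i, k)\<close> with \<open>i\<close> in the window
  and \<open>k < m\<close>: translating the window by \<open>k * s\<close> loses at most
  \<open>m * s\<close> points, and for fixed \<open>i\<close> the number of good \<open>k\<close> is
  at most \<open>v\<close>, or trivially at most \<open>m\<close> when \<open>E i\<close>
  holds.\<close>

lemma card_window_le_average:
  fixes P E :: "int \<Rightarrow> bool" and v :: real
  assumes "v \<ge> 0"
    and v: "\<And>i. \<not> E i \<Longrightarrow> real (card {k. k < m \<and> P (i + int (k * s))}) \<le> v"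
  shows "real m * real (card {i \<in> window B n. P i})
    \<le> v * real n + real m * real (card {i \<in> window B n. E i}) + real m * real (m * s)"
proof -
  let ?c = "\<lambda>Q. card {i \<in> window B n. Q i}"
  have card_sum: "real (?c Q) = (\<Sum>i\<in>window B n. if Q i then 1 else 0)" for Q
    by (simp add: sum.If_cases Int_def)
  have "real m * real (?c P) = (\<Sum>k<m. real (?c P))" by simp
  also have "\<dots> \<le> (\<Sum>k<m. real (?c (\<lambda>i. P (i + int (k * s)))) + real (m * s))"
  proof (rule sum_mono)
    fix k assume "k \<in> {..<m}"
    then have "k * s \<le> m * s" by simp
    moreover have "?c P \<le> ?c (\<lambda>i. P (i + int (k * s))) + k * s"
      unfolding card_window_shift by (rule card_window_le_shifted)
    ultimately have "?c P \<le> ?c (\<lambda>i. P (i + int (k * s))) + m * s" by linarith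
    then show "real (?c P) \<le> real (?c (\<lambda>i. P (i + int (k * s)))) + real (m * s)"
      by linarith
  qed
  also have "\<dots> = (\<Sum>i\<in>window B n. real (card {k. k < m \<and> P (i + int (k * s))})) + real m * real (m * s)"
  proof -
    have "(\<Sum>k<m. real (?c (\<lambda>i. P (i + int (k * s)))))
        = (\<Sum>i\<in>window B n. \<Sum>k<m. if P (i + int (k * s)) then 1 else 0)"
      unfolding card_sum by (rule sum.swap)
    also have "\<dots> = (\<Sum>i\<in>window B n. real (card {k. k < m \<and> P (i + int (k * s))}))"
      by (intro sum.cong refl) (simp add: sum.If_cases Int_def)
    finally show ?thesis by (simp add: sum.distrib)
  qed
  also have "\<dots> \<le> (\<Sum>i\<in>window B n. v + real m * (if E i then 1 else 0)) + real m * real (m * s)"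
  proof (intro add_right_mono sum_mono)
    fix i
    have "card {k. k < m \<and> P (i + int (k * s))} \<le> card {..<m}"
      by (intro card_mono) auto
    then show "real (card {k. k < m \<and> P (i + int (k * s))}) \<le> v + real m * (if E i then 1 else 0)"
      using v[of i] \<open>v \<ge> 0\<close> by auto
  qed
  also have "\<dots> = v * real n + real m * real (?c E) + real m * real (m * s)"
    unfolding card_sum sum.distrib sum_distrib_left by simp
  finally show ?thesis .
qed

text \<open>Multiplication by 2 on the circle of positive reals modulo 6, with fundamental domain
  \<open>[1, 6]\<close>; both branches are allowed at the overlap point 3.\<close>

definition doubling_orbit :: "(int \<Rightarrow> real) \<Rightarrow> bool" where
  "doubling_orbit X \<longleftrightarrow> (\<forall>i. (1 \<le> X i \<and> X i \<le> 3 \<and> X (i + 1) = 2 * X i) \<or>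
                          (3 \<le> X i \<and> X i \<le> 6 \<and> X (i + 1) = X i / 3))"

lemma doubling_orbit_bounds:
  assumes "doubling_orbit X"
  shows "1 \<le> X i" "X i \<le> 6"
  using assms unfolding doubling_orbit_def by (force dest: spec[of _ i])+

text \<open>The branches \<open>2x\<close> and \<open>x / 3\<close> differ by the factor 6, so
  iteration is multiplication by a power of 2 up to a power of 6; each use of the second branch
  raises \<open>z\<close> by one.\<close>

lemma doubling_orbit_iterate:
  assumes X: "doubling_orbit X"
  shows "\<exists>z. X (i + int R) * 6 ^ z = X i * 2 ^ R"
proof (induction R)
  case 0
  show ?case by (auto intro: exI[of _ 0])
next
  case (Suc R)
  then obtain z where z: "X (i + int R) * 6 ^ z = X i * 2 ^ R" by blast
  have e: "i + int (Suc R) = i + int R + 1" by simp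
  consider "X (i + int (Suc R)) = 2 * X (i + int R)" | "X (i + int (Suc R)) = X (i + int R) / 3"
    using X unfolding doubling_orbit_def e by blast
  then show ?case
  proof cases
    case 1
    then show ?thesis using z by (intro exI[of _ z]) simp
  next
    case 2
    then have "X (i + int (Suc R)) * 6 ^ Suc z = 2 * (X (i + int R) * 6 ^ z)" by simp
    then show ?thesis using z by (intro exI[of _ "Suc z"]) simp
  qed
qed

text \<open>\<open>X (i + int r)\<close> and \<open>\<rho> * X i\<close> agree up to a power of 6.
  The first lies in [1, 6] and the second strictly between 1 and 6, so this power is trivial;
  strictness at both ends excludes the identified endpoints 1 and 6.\<close>

lemma doubling_orbit_iterate_nowrap:
  assumes X: "doubling_orbit X" and \<rho>: "\<rho> * 6 ^ q = 2 ^ r" "\<rho> > 1" and less: "\<rho> * X i < 6"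
  shows "X (i + int r) = \<rho> * X i"
proof -
  obtain z where z: "X (i + int r) * 6 ^ z = X i * 2 ^ r"
    using doubling_orbit_iterate[OF X] by blast
  have z': "X (i + int r) * 6 ^ z = (\<rho> * X i) * 6 ^ q"
    using z \<rho> by (simp add: algebra_simps)
  have b: "1 \<le> X (i + int r)" "X (i + int r) \<le> 6" "1 \<le> X i"
    using doubling_orbit_bounds[OF X] by auto
  have b': "1 < \<rho> * X i" using b \<rho> mult_strict_mono'[of 1 \<rho> 1 "X i"]
    by (cases "X i = 1") auto
  have "z = q"
  proof (rule ccontr)
    assume "z \<noteq> q"
    then consider d where "q = z + Suc d" | d where "z = q + Suc d"
      by (metis less_iff_Suc_add linorder_neqE_nat add_Suc_right)
    then show False
    proof cases
      case 1
      then have "X (i + int r) = (\<rho> * X i) * 6 ^ Suc d"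
        using z' by (simp add: power_add)
      moreover have "\<rho> * X i * 6 \<le> \<rho> * X i * 6 ^ Suc d"
        using b' by (intro mult_left_mono) auto
      ultimately show ?thesis using b b' by linarith
    next
      case 2
      then have "X (i + int r) * 6 ^ Suc d = \<rho> * X i"
        using z' by (simp add: power_add)
      moreover have "1 * 6 \<le> X (i + int r) * 6 ^ Suc d"
        using b by (intro mult_mono) auto
      ultimately show ?thesis using less by simp
    qed
  qed
  then show ?thesis using z' by simp
qed

text \<open>The step is \<open>2r\<close> rather than \<open>r\<close> because \<open>6/\<sigma>\<close> and \<open>6\<close>, both in the closed arc, are \<open>r\<close>
  steps apart.\<close>

lemma doubling_orbit_top_visits:
  assumes X: "doubling_orbit X" and \<sigma>: "\<sigma> * 6 ^ q = 2 ^ r" "\<sigma> > 1" "\<sigma> ^ (2 * p) \<le> 6"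
  shows "real p * real (card {i \<in> window B n. 6 / \<sigma> \<le> X i}) \<le> real n + real p * real (p * (2 * r))"
proof -
  \<comment> \<open>A step of length \<open>2 * r\<close> moves by the factor
    \<open>\<sigma> ^ 2\<close> on the circle and so leaves the arc at once; the bound
    \<open>\<sigma> ^ (2 * p) \<le> 6\<close> prevents a return within \<open>p\<close>
    steps.\<close>
  have at_most_one: "card {k. k < p \<and> 6 / \<sigma> \<le> X (i + int (k * (2 * r)))} \<le> 1" for i
  proof -
    have False if "k < k'" "k' < p" and k: "6 / \<sigma> \<le> X (i + int (k * (2 * r)))"
      and k': "6 / \<sigma> \<le> X (i + int (k' * (2 * r)))" for k k'
    proof -
      define d where "d = k' - k"
      define x where "x = X (i + int (k * (2 * r)))"
      define x' where "x' = X (i + int (k' * (2 * r)))"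
      have x: "6 / \<sigma> \<le> x" "x \<le> 6" "6 / \<sigma> \<le> x'" "x' \<le> 6"
        unfolding x_def x'_def using k k' doubling_orbit_bounds[OF X] by auto
      have d: "1 \<le> d" "k' = k + d" using \<open>k < k'\<close> by (auto simp: d_def)
      have "i + int (k' * (2 * r)) = i + int (k * (2 * r)) + int (2 * d * r)"
        unfolding d(2) by (simp add: algebra_simps)
      then obtain z where "x' * 6 ^ z = x * 2 ^ (2 * d * r)"
        using doubling_orbit_iterate[OF X] unfolding x_def x'_def by metis
      also have "2 ^ (2 * d * r) = (\<sigma> * 6 ^ q) ^ (2 * d)"
        unfolding \<sigma> by (simp add: power_mult[symmetric] mult_ac)
      also have "\<dots> = \<sigma> ^ (2 * d) * 6 ^ (2 * d * q)"
        by (simp add: power_mult_distrib power_mult[symmetric] mult_ac)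
      finally have z: "x' * 6 ^ z = x * \<sigma> ^ (2 * d) * 6 ^ (2 * d * q)" by simp
      have pos: "0 < x" "0 < x'" using x \<sigma> by (smt (verit) divide_pos_pos)+
      show False
      \<comment> \<open>Without an extra wrap, \<open>x'\<close> is at least
        \<open>x * \<sigma> ^ (2 * d)\<close>, which exceeds 6. An extra wrap requires
        \<open>\<sigma> ^ (2 * d + 1) \<ge> 6\<close>.\<close>
      proof (cases "z \<le> 2 * d * q")
        case True
        then obtain e where e: "2 * d * q = z + e" using le_Suc_ex by blast
        have "6 < 6 / \<sigma> * \<sigma> ^ 2" using \<sigma> by (simp add: power2_eq_square)
        also have "\<dots> \<le> x * \<sigma> ^ (2 * d)"
          using x d \<sigma> pos by (intro mult_mono power_increasing) auto
        also have "\<dots> \<le> x * \<sigma> ^ (2 * d) * 6 ^ e" using pos \<sigma> by simp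
        also have "\<dots> = x'" using z unfolding e by (simp add: power_add)
        finally show False using x by simp
      next
        case False
        then obtain e where e: "z = 2 * d * q + Suc e"
          by (metis add_Suc_right less_iff_Suc_add not_le)
        have "6 / \<sigma> * 6 \<le> x' * 6 ^ Suc e"
          using x pos \<sigma> by (intro mult_mono) auto
        also have "\<dots> = x * \<sigma> ^ (2 * d)"
          using z unfolding e by (simp add: power_add)
        also have "\<dots> \<le> 6 * \<sigma> ^ (2 * d)" using x \<sigma> by (intro mult_right_mono) auto
        finally have "6 \<le> \<sigma> ^ (2 * d + 1)" using \<sigma> by (simp add: field_simps)
        also have "\<dots> < \<sigma> ^ (2 * p)"
          using d \<open>k' < p\<close> \<sigma> by (intro power_strict_increasing) auto
        finally show False using \<sigma> by simp
      qed
    qed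
    then have "\<And>k k'. \<lbrakk>k \<in> {k. k < p \<and> 6 / \<sigma> \<le> X (i + int (k * (2 * r)))};
        k' \<in> {k. k < p \<and> 6 / \<sigma> \<le> X (i + int (k * (2 * r)))}\<rbrakk> \<Longrightarrow> k = k'"
      by (metis (mono_tags, lifting) mem_Collect_eq linorder_neqE_nat)
    then show ?thesis by (simp add: card_le_Suc0_iff_eq)
  qed
  show ?thesis
    using card_window_le_average[of 1 "\<lambda>_. False" p "\<lambda>i. 6 / \<sigma> \<le> X i" "2 * r" B n] at_most_one
    by simp
qed

section \<open>Geometric sequences near integers\<close>

lemma card_le_of_spread:
  fixes g :: "nat \<Rightarrow> real"
  assumes "finite K" "d > 0" "lo \<le> hi"
    and spread: "\<And>k k'. k \<in> K \<Longrightarrow> k' \<in> K \<Longrightarrow> k < k' \<Longrightarrow> d * real (k' - k) \<le> g k' - g k"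
    and range: "\<And>k. k \<in> K \<Longrightarrow> lo \<le> g k \<and> g k \<le> hi"
  shows "real (card K) \<le> (hi - lo) / d + 1"
proof (cases "K = {}")
  case True
  then show ?thesis using assms by simp
next
  case False
  define a b where "a = Min K" and "b = Max K"
  have ab: "a \<in> K" "b \<in> K" "a \<le> b" and sub: "K \<subseteq> {a..b}"
    using False \<open>finite K\<close> by (auto simp: a_def b_def)
  have "card K \<le> b - a + 1" using card_mono[OF _ sub] ab by simp
  moreover have "d * real (b - a) \<le> hi - lo"
    using spread[OF ab(1,2)] range[OF ab(1)] range[OF ab(2)] ab(3) \<open>lo \<le> hi\<close>
    by (cases "a = b") auto
  then have "real (b - a) \<le> (hi - lo) / d" using \<open>d > 0\<close> by (simp add: field_simps)
  ultimately show ?thesis by linarith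
qed

text \<open>Consecutive terms are at least \<open>a * (\<rho> - 1)\<close> apart by Bernoulli's
  inequality, which bounds the number of terms within \<epsilon> of one integer. The relevant
  integers lie in an interval of length at most \<open>12 + 2 * \<epsilon> \<le> 13\<close>, so
  there are at most 14 of them.\<close>

lemma geometric_near_integer_card:
  fixes a \<rho> \<epsilon> :: real
  assumes a: "a > 0" and \<rho>: "\<rho> > 1" and len: "a * \<rho> ^ m - a \<le> 12" and \<epsilon>: "0 < \<epsilon>" "\<epsilon> \<le> 1/2"
  shows "real (card {k. k < m \<and> (\<exists>Z::int. \<bar>a * \<rho> ^ k - of_int Z\<bar> \<le> \<epsilon>)})
    \<le> 14 * (2 * \<epsilon> / (a * (\<rho> - 1)) + 1)"
proof -
  define K where "K Z = {k. k < m \<and> \<bar>a * \<rho> ^ k - of_int Z\<bar> \<le> \<epsilon>}" for Z :: int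
  define I where "I = {\<lceil>a - \<epsilon>\<rceil>..\<lfloor>a * \<rho> ^ m + \<epsilon>\<rfloor>}"
  have "real (card (K Z)) \<le> ((of_int Z + \<epsilon>) - (of_int Z - \<epsilon>)) / (a * (\<rho> - 1)) + 1" for Z
  proof (rule card_le_of_spread[where g = "\<lambda>k. a * \<rho> ^ k"])
    fix k k' :: nat assume "k < k'"
    then obtain e where e: "k' = k + e" using less_imp_add_positive by blast
    have "real e * (\<rho> - 1) \<le> \<rho> ^ e - 1"
      using Bernoulli_inequality[of "\<rho> - 1" e] \<rho> by simp
    also have "\<dots> \<le> \<rho> ^ k * (\<rho> ^ e - 1)"
      using mult_right_mono[of 1 "\<rho> ^ k" "\<rho> ^ e - 1"] \<rho> by simp
    finally have "a * (real e * (\<rho> - 1)) \<le> a * (\<rho> ^ k * (\<rho> ^ e - 1))"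
      using a by (intro mult_left_mono) auto
    then show "a * (\<rho> - 1) * real (k' - k) \<le> a * \<rho> ^ k' - a * \<rho> ^ k"
      unfolding e by (simp add: power_add algebra_simps)
  qed (use a \<rho> \<epsilon> in \<open>auto simp: K_def abs_le_iff\<close>)
  then have each: "real (card (K Z)) \<le> 2 * \<epsilon> / (a * (\<rho> - 1)) + 1" for Z
    by (simp add: algebra_simps)
  have I: "real (card I) \<le> 14"
  proof -
    have "real_of_int (\<lfloor>a * \<rho> ^ m + \<epsilon>\<rfloor> - \<lceil>a - \<epsilon>\<rceil>) \<le> 13" using len \<epsilon> by linarith
    then have "\<lfloor>a * \<rho> ^ m + \<epsilon>\<rfloor> - \<lceil>a - \<epsilon>\<rceil> \<le> 13" by linarith
    then show ?thesis by (simp add: I_def)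
  qed
  have "{k. k < m \<and> (\<exists>Z::int. \<bar>a * \<rho> ^ k - of_int Z\<bar> \<le> \<epsilon>)} \<subseteq> (\<Union>Z\<in>I. K Z)"
  proof clarify
    fix k Z assume k: "k < m" "\<bar>a * \<rho> ^ k - of_int Z\<bar> \<le> \<epsilon>"
    have "a * 1 \<le> a * \<rho> ^ k" "a * \<rho> ^ k \<le> a * \<rho> ^ m"
      using a \<rho> k by (intro mult_left_mono one_le_power power_increasing; simp)+
    then have "Z \<in> I" using k(2) unfolding I_def by (auto simp: abs_le_iff ceiling_le_iff le_floor_iff)
    then show "k \<in> (\<Union>Z\<in>I. K Z)" using k by (auto simp: K_def)
  qed
  then have "card {k. k < m \<and> (\<exists>Z::int. \<bar>a * \<rho> ^ k - of_int Z\<bar> \<le> \<epsilon>)} \<le> card (\<Union>Z\<in>I. K Z)"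
    by (intro card_mono) (auto simp: I_def K_def)
  also have "\<dots> \<le> (\<Sum>Z\<in>I. card (K Z))" by (rule card_UN_le) (simp add: I_def)
  finally have "real (card {k. k < m \<and> (\<exists>Z::int. \<bar>a * \<rho> ^ k - of_int Z\<bar> \<le> \<epsilon>)})
      \<le> (\<Sum>Z\<in>I. real (card (K Z)))" by (simp flip: of_nat_sum)
  also have "\<dots> \<le> (\<Sum>Z\<in>I. 2 * \<epsilon> / (a * (\<rho> - 1)) + 1)" by (intro sum_mono each)
  also have "\<dots> = real (card I) * (2 * \<epsilon> / (a * (\<rho> - 1)) + 1)" by simp
  also have "\<dots> \<le> 14 * (2 * \<epsilon> / (a * (\<rho> - 1)) + 1)"
    using I a \<rho> \<epsilon> by (intro mult_right_mono) (auto intro!: add_nonneg_nonneg divide_nonneg_nonneg)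
  finally show ?thesis .
qed

section \<open>Quotients of powers of 2 and 6 close to 1\<close>

lemma log_6_2_irrational: "log 6 2 \<notin> \<rat>"
proof
  assume "log 6 2 \<in> \<rat>"
  then obtain m n :: nat where n: "n \<noteq> 0" and mn: "\<bar>log 6 2\<bar> = real m / real n"
    by (rule Rats_abs_nat_div_natE)
  have "log 6 (2::real) > 0" by simp
  then have eq: "real n * log 6 2 = real m" using n mn by (simp add: field_simps)
  have "0 < real n * log 6 2" using n \<open>log 6 2 > 0\<close> by simp
  then have "m > 0" unfolding eq by simp
  have "log 6 (2 ^ n) = log 6 (6 ^ m)" using eq by (simp add: log_nat_power)
  then have "(2::real) ^ n = 6 ^ m" using inj_onD[OF log_inj[of 6], of "2 ^ n" "6 ^ m"] by simp
  then have "(2::nat) ^ n = 6 ^ m" by (metis of_nat_eq_iff of_nat_numeral of_nat_power)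
  moreover have "(3::nat) dvd 6 ^ m" using \<open>m > 0\<close> by (intro dvd_trans[OF _ dvd_power]) auto
  ultimately have "(3::nat) dvd 2 ^ n" by simp
  then have "(3::nat) dvd 2" by (rule prime_dvd_power[rotated]) simp
  then show False by simp
qed

text \<open>By Kronecker's theorem some multiple of the irrational number \<open>log 6 2\<close> has
  a small positive fractional part \<open>f\<close>; then \<open>\<rho>\<close> is
  \<open>6 powr f\<close> and \<open>q\<close> is the integer part.\<close>

lemma power_ratio_near_one:
  fixes \<eta> :: real
  assumes "\<eta> > 0"
  obtains \<rho> :: real and q r :: nat where "\<rho> * 6 ^ q = 2 ^ r" "1 < \<rho>" "\<rho> \<le> 1 + \<eta>"
proof -
  define \<delta> where "\<delta> = min (1/2) (log 6 (1 + \<eta>) / 2)"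
  have \<delta>: "0 < \<delta>" "\<delta> \<le> 1/2" "2 * \<delta> \<le> log 6 (1 + \<eta>)" using assms by (auto simp: \<delta>_def)
  \<comment> \<open>Target and tolerance are both \<delta>, so the fractional part lies strictly
    between 0 and \<open>2 * \<delta>\<close>; positivity is what gives
    \<open>\<rho> > 1\<close>.\<close>
  obtain r where r: "\<bar>frac (real r * log 6 2) - \<delta>\<bar> < \<delta>"
    using Kronecker_approx_1_explicit[OF log_6_2_irrational, of \<delta> \<delta>] \<delta> by auto
  define f where "f = frac (real r * log 6 2)"
  have f: "0 < f" "f < log 6 (1 + \<eta>)" using r \<delta> unfolding f_def by linarith+
  define q where "q = nat \<lfloor>real r * log 6 2\<rfloor>"
  have rq: "real r * log 6 2 = f + real q" by (simp add: f_def q_def frac_def)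
  show ?thesis
  proof (rule that)
    have "6 powr f * 6 ^ q = 6 powr (real r * log 6 2)"
      unfolding rq by (simp add: powr_add powr_realpow)
    also have "\<dots> = (6 powr log 6 2) powr real r" by (simp only: powr_powr mult.commute)
    also have "\<dots> = 2 ^ r" by (simp add: powr_realpow)
    finally show "6 powr f * 6 ^ q = 2 ^ r" .
    show "1 < 6 powr f" using f by simp
    have "6 powr f \<le> 6 powr log 6 (1 + \<eta>)" using f by (intro powr_mono) auto
    then show "6 powr f \<le> 1 + \<eta>" using assms by simp
  qed
qed

section \<open>Density of nearly integral orbit sums\<close>

lemma power_diff_one_le:
  fixes \<rho> :: real
  assumes "\<rho> \<ge> 1"
  shows "\<rho> ^ m - 1 \<le> real m * \<rho> ^ m * (\<rho> - 1)"
proof -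
  have "\<rho> ^ m - 1 = (\<rho> - 1) * (\<Sum>i<m. \<rho> ^ i)" by (rule power_diff_1_eq)
  also have "\<dots> \<le> (\<rho> - 1) * (\<Sum>i<m. \<rho> ^ m)"
    using assms by (intro mult_left_mono sum_mono power_increasing) auto
  finally show ?thesis by (simp add: mult_ac)
qed

text \<open>Passing from \<open>i\<close> to \<open>i + k * r\<close> multiplies the sum by
  \<open>\<rho> ^ k\<close> as long as no summand is carried past 6. For \<open>k < m\<close> the
  values then sweep geometrically through a stretch of length at most 12 and are rarely near
  integers, which accounts for \<open>98 / M\<close>. The positions with a summand close to 6
  account for \<open>4 / M\<close>.\<close>

lemma near_integer_sums_density:
  assumes X: "doubling_orbit X" and "M' > 0" "b > 0" and M: "M = 4 * M'"
  shows "\<exists>C. \<forall>n B. real (card {i \<in> window B n.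
      \<exists>Z::int. \<bar>real M * (\<Sum>l<b. X (i + int l)) - of_int Z\<bar> \<le> 1 / real M}) \<le> 102 / real M * real n + C"
proof -
  \<comment> \<open>The quantity followed lies between \<open>M * b\<close> and
    \<open>6 * (M * b)\<close>, so a relative growth between \<open>w\<close> and
    \<open>2 * w\<close> moves it by at least 1 and at most 12.\<close>
  define w where "w = 1 / (real M * real b)"
  have M4: "real M \<ge> 4" "real b \<ge> 1" using \<open>M' > 0\<close> \<open>b > 0\<close> M by auto
  have Mb: "real M * real b \<ge> 4 * 1" using M4 by (intro mult_mono) auto
  have w: "0 < w" "w \<le> 1" "w * (real M * real b) = 1" using Mb M4 \<open>b > 0\<close> by (auto simp: w_def)
  have wM: "w / (4 * real M) > 0" "w / (4 * real M) \<le> 1/4"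
    using w M4 mult_mono[of w 1 1 "real M"] by (auto simp: field_simps)
  \<comment> \<open>The fineness \<open>w / (4 * M)\<close> forces a sweep to have at least
    \<open>M\<close> steps (\<open>m_ge\<close>), so that the summand 1 in the count for each
    integer is at most \<open>m / M\<close>.\<close>
  obtain \<rho> q r where \<rho>: "\<rho> * 6 ^ q = 2 ^ r" "1 < \<rho>" "\<rho> \<le> 1 + w / (4 * real M)"
    using power_ratio_near_one wM by blast
  define m where "m = (LEAST m. 1 + w \<le> \<rho> ^ m)"
  have ex: "\<exists>m. 1 + w \<le> \<rho> ^ m"
    using real_arch_pow[OF \<rho>(2)] by (meson less_imp_le)
  have m: "1 + w \<le> \<rho> ^ m" unfolding m_def by (rule LeastI_ex[OF ex])
  then have "m > 0" using w by (auto intro: gr0I)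
  define \<sigma> where "\<sigma> = \<rho> ^ m"
  \<comment> \<open>Minimality of \<open>m\<close> limits the overshoot of \<sigma> beyond
    \<open>1 + w\<close> to one factor \<rho>.\<close>
  have "\<rho> ^ (m - 1) < 1 + w"
    using not_less_Least[of "m - 1" "\<lambda>m. 1 + w \<le> \<rho> ^ m"] \<open>m > 0\<close> unfolding m_def by linarith
  then have "\<sigma> \<le> (1 + w) * \<rho>"
    using \<open>m > 0\<close> \<rho> mult_right_mono[of "\<rho> ^ (m - 1)" "1 + w" \<rho>]
    by (cases m) (auto simp: \<sigma>_def mult.commute)
  also have "\<dots> \<le> (1 + w) * (1 + w / 4)"
  proof (intro mult_left_mono)
    have "w / (4 * real M) \<le> w / 4" using w M4 by (intro divide_left_mono) auto
    then show "\<rho> \<le> 1 + w / 4" using \<rho> by linarith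
  qed (use w in auto)
  also have "\<dots> \<le> 1 + 2 * w" using w mult_mono[of w 1 w w] by (simp add: algebra_simps)
  finally have \<sigma>: "1 + w \<le> \<sigma>" "\<sigma> \<le> 1 + 2 * w" "\<sigma> \<le> 3" using m w by (auto simp: \<sigma>_def)
  have \<sigma>pow: "\<sigma> * 6 ^ (m * q) = 2 ^ (m * r)"
    unfolding \<sigma>_def by (metis \<rho>(1) power_mult mult.commute power_mult_distrib)
  \<comment> \<open>Chosen so that \<open>p * w = 1/4\<close>: then
    \<open>\<sigma> ^ (2 * p)\<close> is at most \<open>exp (4 * p * w) = exp 1\<close>, as the
    bound on top visits demands. The factor 4 in \<open>M\<close> makes \<open>p\<close> an
    integer.\<close>
  define p where "p = M' * b"
  have p: "real p > 0" "p > 0" using \<open>M' > 0\<close> \<open>b > 0\<close> by (auto simp: p_def)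
  have pw: "real p * w = 1/4" using w(3) unfolding p_def M by (simp add: algebra_simps)
  have "\<sigma> ^ (2 * p) \<le> exp (2 * w) ^ (2 * p)"
    using \<sigma> w exp_ge_add_one_self[of "2 * w"] by (intro power_mono) linarith+
  also have "\<dots> = exp 1" using pw by (simp add: exp_of_nat_mult[symmetric] mult_ac)
  also have "\<dots> \<le> 6" using exp_le by simp
  finally have \<sigma>p: "\<sigma> ^ (2 * p) \<le> 6" .

  \<comment> \<open>A lower bound for the speed of the sweep: its \<open>m\<close> steps together
    achieve the relative growth \<open>w\<close>, and 3 bounds \<sigma>.\<close>
  have mw: "w \<le> 3 * real m * (\<rho> - 1)"
  proof -
    have "w \<le> \<sigma> - 1" using \<sigma> by simp
    also have "\<dots> \<le> real m * \<sigma> * (\<rho> - 1)" unfolding \<sigma>_def using \<rho> by (intro power_diff_one_le) auto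
    also have "\<dots> \<le> real m * 3 * (\<rho> - 1)"
      using \<sigma> \<rho> by (intro mult_right_mono mult_left_mono) auto
    finally show ?thesis by (simp add: mult_ac)
  qed
  have m_ge: "real m \<ge> real M"
  proof -
    have "3 * real m * (\<rho> - 1) \<le> 3 * real m * (w / (4 * real M))"
      using \<rho> by (intro mult_left_mono) auto
    then have "w * 1 \<le> w * (3 * real m / (4 * real M))" using mw by (simp add: mult_ac)
    then have "1 \<le> 3 * real m / (4 * real M)" using w by (subst (asm) mult_le_cancel_left_pos) auto
    then show ?thesis using M4 by (simp add: field_simps)
  qed

  define S where "S i = (\<Sum>l<b. X (i + int l))" for i
  define P where "P i \<longleftrightarrow> (\<exists>Z::int. \<bar>real M * S i - of_int Z\<bar> \<le> 1 / real M)" for i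
  \<comment> \<open>The exceptional positions: some summand would reach 6 when multiplied by
    \<sigma>.\<close>
  define E where "E i \<longleftrightarrow> (\<exists>l<b. 6 / \<sigma> \<le> X (i + int l))" for i
  have bounds: "1 \<le> X i" "X i \<le> 6" for i using doubling_orbit_bounds[OF X] by auto
  have S: "real b \<le> S i" "S i \<le> 6 * real b" for i
    unfolding S_def using sum_mono[of "{..<b}" "\<lambda>_. 1" "\<lambda>l. X (i + int l)"]
      sum_mono[of "{..<b}" "\<lambda>l. X (i + int l)" "\<lambda>_. 6"] bounds by auto

  have few: "real (card {k. k < m \<and> P (i + int (k * r))}) \<le> 98 / real M * real m" if "\<not> E i" for i
  proof -
    have step: "S (i + int (k * r)) = \<rho> ^ k * S i" if "k < m" for k
    proof (cases "k = 0")
      case False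
      have "X (i + int l + int (k * r)) = \<rho> ^ k * X (i + int l)" if "l < b" for l
      proof (rule doubling_orbit_iterate_nowrap[OF X])
        show "\<rho> ^ k * 6 ^ (k * q) = 2 ^ (k * r)"
          by (metis \<rho>(1) power_mult mult.commute power_mult_distrib)
        show "1 < \<rho> ^ k" using \<rho> False by simp
        have "\<rho> ^ k * X (i + int l) \<le> \<sigma> * X (i + int l)"
          unfolding \<sigma>_def using \<rho> \<open>k < m\<close> bounds(1)[of "i + int l"]
          by (intro mult_right_mono power_increasing) auto
        also have "\<dots> < 6" using \<open>\<not> E i\<close> \<open>l < b\<close> \<sigma> w by (auto simp: E_def field_simps not_le)
        finally show "\<rho> ^ k * X (i + int l) < 6" .
      qed
      then show ?thesis
        unfolding S_def sum_distrib_left by (intro sum.cong refl) (simp add: algebra_simps)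
    qed simp
    define a where "a = real M * S i"
    have a: "real M * real b \<le> a" "a \<le> 6 * (real M * real b)"
      using mult_left_mono[OF S(1)[of i], of "real M"] mult_left_mono[OF S(2)[of i], of "real M"]
      by (auto simp: a_def)
    have "{k. k < m \<and> P (i + int (k * r))} =
        {k. k < m \<and> (\<exists>Z::int. \<bar>a * \<rho> ^ k - of_int Z\<bar> \<le> 1 / real M)}"
      using step by (auto simp: P_def a_def mult_ac)
    also have "real (card \<dots>) \<le> 14 * (2 * (1 / real M) / (a * (\<rho> - 1)) + 1)"
    proof (rule geometric_near_integer_card)
      have "a * (\<sigma> - 1) \<le> 6 * (real M * real b) * (2 * w)"
        using a \<sigma> w Mb by (intro mult_mono) auto
      also have "\<dots> = 12" using w(3) by (simp add: mult_ac)
      finally show "a * \<rho> ^ m - a \<le> 12" by (simp add: \<sigma>_def algebra_simps)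
    qed (use a Mb \<rho> M4 \<open>b > 0\<close> in \<open>auto simp: field_simps\<close>)
    \<comment> \<open>Each of the 14 integers costs at most \<open>6 * m / M\<close> for the passage
      through its neighbourhood and \<open>m / M\<close> for the summand 1;
      \<open>14 * 7 = 98\<close>.\<close>
    also have "\<dots> \<le> 14 * (6 * real m / real M + real m / real M)"
    proof (intro mult_left_mono add_mono)
      have "1 / (a * (\<rho> - 1)) \<le> 1 / (real M * real b * (\<rho> - 1))"
        using a Mb \<rho> \<open>M' > 0\<close> \<open>b > 0\<close> M by (intro divide_left_mono mult_right_mono mult_pos_pos) auto
      also have "\<dots> = w / (\<rho> - 1)" by (simp add: w_def)
      also have "\<dots> \<le> 3 * real m" using mw \<rho> by (simp add: field_simps)
      finally have "2 / real M * (1 / (a * (\<rho> - 1))) \<le> 2 / real M * (3 * real m)"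
        by (intro mult_left_mono) auto
      then show "2 * (1 / real M) / (a * (\<rho> - 1)) \<le> 6 * real m / real M" by simp
    qed (use m_ge M4 in \<open>auto simp: field_simps\<close>)
    also have "\<dots> = 98 / real M * real m" by (simp add: field_simps)
    finally show ?thesis .
  qed

  \<comment> \<open>A union bound over the \<open>b\<close> summands: each is in the top arc with
    density at most \<open>1 / p\<close>, and \<open>b / p = 1 / M' = 4 / M\<close>.\<close>
  have E_count: "real (card {i \<in> window B n. E i}) \<le> 4 / real M * real n + real b * real (p * (2 * (m * r)))"
    for B n
  proof -
    have "{i \<in> window B n. E i} = (\<Union>l<b. {i \<in> window B n. 6 / \<sigma> \<le> X (i + int l)})"
      by (auto simp: E_def)
    then have "card {i \<in> window B n. E i} \<le> (\<Sum>l<b. card {i \<in> window B n. 6 / \<sigma> \<le> X (i + int l)})"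
      using card_UN_le[of "{..<b}"] by simp
    then have "real (card {i \<in> window B n. E i})
        \<le> (\<Sum>l<b. real (card {i \<in> window (B + int l) n. 6 / \<sigma> \<le> X i}))"
      unfolding card_window_shift[where P = "\<lambda>i. 6 / \<sigma> \<le> X i"] of_nat_sum[symmetric] by linarith
    also have "\<dots> \<le> (\<Sum>l<b. real n / real p + real (p * (2 * (m * r))))"
    proof (rule sum_mono)
      fix l
      have "real p * real (card {i \<in> window (B + int l) n. 6 / \<sigma> \<le> X i})
          \<le> real n + real p * real (p * (2 * (m * r)))"
        using doubling_orbit_top_visits[OF X \<sigma>pow _ \<sigma>p] \<sigma> w by simp
      then show "real (card {i \<in> window (B + int l) n. 6 / \<sigma> \<le> X i})
          \<le> real n / real p + real (p * (2 * (m * r)))"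
        using p by (simp add: field_simps)
    qed
    also have "\<dots> = real b * (real n / real p) + real b * real (p * (2 * (m * r)))"
      by (simp add: algebra_simps)
    also have "real b * (real n / real p) = 4 / real M * real n"
      using \<open>b > 0\<close> \<open>M' > 0\<close> unfolding p_def M by (simp add: field_simps)
    finally show ?thesis .
  qed

  have "real (card {i \<in> window B n. P i})
      \<le> 102 / real M * real n + (real b * real (p * (2 * (m * r))) + real (m * r))" for B n
  proof -
    have "real m * real (card {i \<in> window B n. P i}) \<le> 98 / real M * real m * real n
        + real m * real (card {i \<in> window B n. E i}) + real m * real (m * r)"
      using few by (intro card_window_le_average) auto
    also have "\<dots> = real m * (98 / real M * real n + real (card {i \<in> window B n. E i}) + real (m * r))"
      by (simp add: algebra_simps)
    finally have "real (card {i \<in> window B n. P i})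
        \<le> 98 / real M * real n + real (card {i \<in> window B n. E i}) + real (m * r)"
      using \<open>m > 0\<close> by simp
    also have "\<dots> \<le> 98 / real M * real n
        + (4 / real M * real n + real b * real (p * (2 * (m * r)))) + real (m * r)"
      using E_count[of B n] by simp
    also have "\<dots> = 102 / real M * real n + (real b * real (p * (2 * (m * r))) + real (m * r))"
      by (simp add: add_divide_distrib[symmetric] algebra_simps)
    finally show ?thesis .
  qed
  then show ?thesis unfolding P_def S_def by blast
qed

subsection \<open>Tiles whose rows follow an affine dynamical system\<close>

text \<open>The southern digits \<open>s\<close> average to \<open>(x, My)\<close> for the current row, the northern digits \<open>n\<close> to
  those of the next one; \<open>w\<close> and \<open>v\<close> are the carries entering in the west and leaving in the
  east. The flag \<open>e\<close> selects the branch \<open>x \<mapsto> 2x\<close>, \<open>k\<close> is the integer subtracted from \<open>y + Mx\<close>, and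
  the digit condition involving \<open>j\<close> forces \<open>j \<le> My \<le> j + 1\<close>.\<close>

definition beatty_tile ::
  "nat \<Rightarrow> bool \<Rightarrow> int \<Rightarrow> int \<Rightarrow> int \<times> int \<Rightarrow> int \<times> int \<Rightarrow> int \<times> int \<Rightarrow> int \<times> int \<Rightarrow> bool"
where
  "beatty_tile M e j k s n w v \<longleftrightarrow>
     (case (s, n, w, v) of ((dx, dy), (dx', dy'), (cx, cy), (cx', cy')) \<Rightarrow>
       (if e then dx \<in> {1..3} \<and> cx + 2 * dx = dx' + cx'
             else dx \<in> {3..6} \<and> cx + dx = 3 * dx' + cx') \<and>
       cy + (dy + int (M * M) * dx) = (dy' + int M * k) + cy' \<and>
       j \<in> {0..<int M} \<and> k \<in> {0..6 * int M + 1} \<and> dy \<in> {j..j + 1} \<and>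
       dx' \<in> {1..6} \<and> dy' \<in> {0..int M} \<and>
       cx \<in> {0..3} \<and> cx' \<in> {0..3} \<and> cy \<in> {0..int (M * M) + 1} \<and> cy' \<in> {0..int (M * M) + 1})"

text \<open>The triple \<open>(e, j, k)\<close> belongs to both the east and the west colour, which
  makes it constant along each row of a tiling; the digits are passed vertically and the carries
  horizontally.\<close>

definition beatty_tile_set :: "nat \<Rightarrow> tile set" where
  "beatty_tile_set M = {(to_nat n, to_nat (v, e, j, k), to_nat s, to_nat (w, e, j, k)) |
     e j k s n w v. beatty_tile M e j k s n w v}"

lemma finite_beatty_tile_set: "finite (beatty_tile_set M)"
proof (rule finite_subset)
  let ?B = "{0..6 * int M + int (M * M) + 6}"
  let ?f = "\<lambda>(e :: bool, j :: int, k :: int, s :: int \<times> int, n :: int \<times> int, w :: int \<times> int, v :: int \<times> int).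
    (to_nat n, to_nat (v, e, j, k), to_nat s, to_nat (w, e, j, k))"
  show "beatty_tile_set M \<subseteq>
      ?f ` (UNIV \<times> ?B \<times> ?B \<times> (?B \<times> ?B) \<times> (?B \<times> ?B) \<times> (?B \<times> ?B) \<times> (?B \<times> ?B))"
  proof
    fix t assume "t \<in> beatty_tile_set M"
    then obtain e j k dx dy dx' dy' cx cy cx' cy' where
      t: "t = ?f (e, j, k, (dx, dy), (dx', dy'), (cx, cy), (cx', cy'))"
      and tile: "beatty_tile M e j k (dx, dy) (dx', dy') (cx, cy) (cx', cy')"
      unfolding beatty_tile_set_def by auto
    have "0 \<le> int (M * M)" by simp
    then have "{j, k, dx, dy, dx', dy', cx, cy, cx', cy'} \<subseteq> ?B"
      using tile unfolding beatty_tile_def by (simp split: if_splits)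
    then show "t \<in> ?f ` (UNIV \<times> ?B \<times> ?B \<times> (?B \<times> ?B) \<times> (?B \<times> ?B) \<times> (?B \<times> ?B) \<times> (?B \<times> ?B))"
      unfolding t by (intro imageI) simp
  qed
qed simp

lemma beatty_tileD:
  assumes "beatty_tile M e j k s n w v"
  shows "e \<Longrightarrow> real_of_int (fst w) + 2 * real_of_int (fst s) = real_of_int (fst n) + real_of_int (fst v)"
    "\<not> e \<Longrightarrow> real_of_int (fst w) + real_of_int (fst s) = 3 * real_of_int (fst n) + real_of_int (fst v)"
    "e \<Longrightarrow> 1 \<le> real_of_int (fst s) \<and> real_of_int (fst s) \<le> 3"
    "\<not> e \<Longrightarrow> 3 \<le> real_of_int (fst s) \<and> real_of_int (fst s) \<le> 6"
    "1 \<le> real_of_int (fst n)" "real_of_int (fst n) \<le> 6"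
    "real_of_int (snd w) + (real_of_int (snd s) + real (M * M) * real_of_int (fst s))
      = (real_of_int (snd n) + real M * real_of_int k) + real_of_int (snd v)"
    "0 \<le> real_of_int (snd n)" "real_of_int (snd n) \<le> real M"
    "\<bar>real_of_int (fst w)\<bar> \<le> 3" "\<bar>real_of_int (snd w)\<bar> \<le> real (M * M) + 1"
    "real_of_int j \<le> real_of_int (snd s)" "real_of_int (snd s) \<le> real_of_int j + 1"
proof -
  obtain dx dy dx' dy' cx cy cx' cy' where
    eq: "s = (dx, dy)" "n = (dx', dy')" "w = (cx, cy)" "v = (cx', cy')" by (metis surj_pair)
  note t = assms[unfolded beatty_tile_def eq prod.case]
  show "e \<Longrightarrow> real_of_int (fst w) + 2 * real_of_int (fst s) = real_of_int (fst n) + real_of_int (fst v)"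
    "\<not> e \<Longrightarrow> real_of_int (fst w) + real_of_int (fst s) = 3 * real_of_int (fst n) + real_of_int (fst v)"
    "e \<Longrightarrow> 1 \<le> real_of_int (fst s) \<and> real_of_int (fst s) \<le> 3"
    "\<not> e \<Longrightarrow> 3 \<le> real_of_int (fst s) \<and> real_of_int (fst s) \<le> 6"
    "1 \<le> real_of_int (fst n)" "real_of_int (fst n) \<le> 6"
    "\<bar>real_of_int (fst w)\<bar> \<le> 3"
    "real_of_int j \<le> real_of_int (snd s)" "real_of_int (snd s) \<le> real_of_int j + 1"
    using t unfolding eq by (simp_all split: if_splits)
  have "real_of_int (cy + (dy + int (M * M) * dx)) = real_of_int ((dy' + int M * k) + cy')"
    using t by metis
  then show "real_of_int (snd w) + (real_of_int (snd s) + real (M * M) * real_of_int (fst s))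
      = (real_of_int (snd n) + real M * real_of_int k) + real_of_int (snd v)"
    unfolding eq by simp
  have "0 \<le> dy'" "dy' \<le> int M" "0 \<le> cy" "cy \<le> int (M * M + 1)" using t by simp_all
  then show "0 \<le> real_of_int (snd n)" "real_of_int (snd n) \<le> real M"
    "\<bar>real_of_int (snd w)\<bar> \<le> real (M * M) + 1"
    unfolding eq by (auto simp flip: of_nat_mult)
qed

section \<open>Averages of digits along a row\<close>

definition average :: "(nat \<Rightarrow> real) \<Rightarrow> nat \<Rightarrow> real" where
  "average f n = (\<Sum>i<Suc n. f i) / real (Suc n)"

lemma average_add: "average (\<lambda>i. f i + g i) n = average f n + average g n"
  by (simp add: average_def sum.distrib add_divide_distrib del: sum.lessThan_Suc)

lemma average_cmult: "average (\<lambda>i. c * f i) n = c * average f n"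
  by (simp add: average_def sum_distrib_left[symmetric] del: sum.lessThan_Suc)

lemma average_const: "average (\<lambda>i. c) n = c"
  by (simp add: average_def del: sum.lessThan_Suc of_nat_Suc)

lemma average_mono: "(\<And>i. f i \<le> g i) \<Longrightarrow> average f n \<le> average g n"
  unfolding average_def by (intro divide_right_mono sum_mono) auto

lemma average_bounds:
  assumes "\<And>i. a \<le> f i" "\<And>i. f i \<le> b"
  shows "a \<le> average f n" "average f n \<le> b"
  using average_mono[of "\<lambda>_. a" f n] average_mono[of f "\<lambda>_. b" n] assms
  by (auto simp: average_const)

text \<open>The carries telescope, so the two partial sums differ by at most \<open>2 * L\<close>,
  which vanishes after division by the number of terms.\<close>

lemma average_carry_tendsto:
  fixes c :: "nat \<Rightarrow> real"
  assumes carry: "\<And>i. c i + f i = g i + c (Suc i)" and c: "\<And>i. \<bar>c i\<bar> \<le> L"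
  shows "(\<lambda>n. average g n - average f n) \<longlonglongrightarrow> 0"
proof (rule Lim_null_comparison)
  show "(\<lambda>n. 2 * L * inverse (real (Suc n))) \<longlonglongrightarrow> 0"
    using tendsto_mult_right_zero[OF LIMSEQ_inverse_real_of_nat] by blast
  have "norm (average g n - average f n) \<le> 2 * L * inverse (real (Suc n))" for n
  proof -
    have "average g n - average f n = (\<Sum>i<Suc n. g i - f i) / real (Suc n)"
      by (simp add: average_def sum_subtractf diff_divide_distrib del: sum.lessThan_Suc of_nat_Suc)
    also have "(\<Sum>i<Suc n. g i - f i) = (\<Sum>i<Suc n. c i - c (Suc i))"
      using carry by (intro sum.cong refl) (smt (verit))
    also have "\<dots> = c 0 - c (Suc n)" by (rule sum_lessThan_telescope')
    finally have "norm (average g n - average f n) = \<bar>c 0 - c (Suc n)\<bar> * inverse (real (Suc n))"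
      by (simp add: divide_inverse abs_mult)
    also have "\<dots> \<le> 2 * L * inverse (real (Suc n))"
      using c[of 0] c[of "Suc n"] by (intro mult_right_mono) auto
    finally show ?thesis .
  qed
  then show "\<forall>\<^sub>F n in sequentially. norm (average g n - average f n) \<le> 2 * L * inverse (real (Suc n))"
    by simp
qed

lemma shift_invariant_imp_const:
  fixes f :: "int \<Rightarrow> 'a"
  assumes "\<And>i. f (i + 1) = f i"
  shows "f i = f 0"
proof (induction i rule: int_induct[of _ 0])
  case (step2 i)
  then show ?case using assms[of "i - 1"] by simp
qed (use assms in auto)

text \<open>The south colour decodes to the digits and the west colour to the carry and the row
  data. The latter are constant in a row, so column 0 represents them; equal tiles have equal west
  colours and hence equal labels, whatever their columns.\<close>

lemma beatty_tiling_rows: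
  assumes U: "tiling (beatty_tile_set M) U"
  obtains e :: "int \<Rightarrow> bool" and label k :: "int \<Rightarrow> int" and D C :: "int \<times> int \<Rightarrow> int \<times> int"
  where "\<forall>i j. beatty_tile M (e j) (label j) (k j) (D (i, j)) (D (i, j + 1)) (C (i, j)) (C (i + 1, j))"
    and "\<forall>i j i' j'. U (i, j) = U (i', j') \<longrightarrow> label j = label j'"
proof -
  define D :: "int \<times> int \<Rightarrow> int \<times> int" where "D x = from_nat (south (U x))" for x
  define W :: "int \<times> int \<Rightarrow> (int \<times> int) \<times> bool \<times> int \<times> int"
    where "W x = from_nat (west (U x))" for x
  have tile: "beatty_tile M (fst (snd (W (i, j)))) (fst (snd (snd (W (i, j))))) (snd (snd (snd (W (i, j)))))
        (D (i, j)) (D (i, j + 1)) (fst (W (i, j))) (fst (W (i + 1, j)))"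
    and const: "snd (W (i + 1, j)) = snd (W (i, j))" for i j
  proof -
    have "U (i, j) \<in> beatty_tile_set M" using U by (simp add: tiling_def)
    then obtain e l k s n w v where
      t: "U (i, j) = (to_nat n, to_nat (v, e, l, k), to_nat s, to_nat (w, e, l, k))"
      and b: "beatty_tile M e l k s n w v"
      unfolding beatty_tile_set_def by auto
    have "west (U (i + 1, j)) = to_nat (v, e, l, k)" "south (U (i, j + 1)) = to_nat n"
      using U t unfolding tiling_def by (metis east_def north_def fst_conv snd_conv)+
    then have "D (i, j) = s" "D (i, j + 1) = n" "W (i, j) = (w, e, l, k)" "W (i + 1, j) = (v, e, l, k)"
      unfolding D_def W_def t by (simp_all add: south_def west_def)
    then show "beatty_tile M (fst (snd (W (i, j)))) (fst (snd (snd (W (i, j))))) (snd (snd (snd (W (i, j)))))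
        (D (i, j)) (D (i, j + 1)) (fst (W (i, j))) (fst (W (i + 1, j)))"
      "snd (W (i + 1, j)) = snd (W (i, j))" using b by simp_all
  qed
  have const0: "snd (W (i, j)) = snd (W (0, j))" for i j
    using shift_invariant_imp_const[of "\<lambda>i. snd (W (i, j))"] const by blast
  show ?thesis
  proof (rule that; intro allI impI)
    show "beatty_tile M (fst (snd (W (0, j)))) (fst (snd (snd (W (0, j))))) (snd (snd (snd (W (0, j)))))
        (D (i, j)) (D (i, j + 1)) (fst (W (i, j))) (fst (W (i + 1, j)))" for i j
      using tile[of i j] unfolding const0[of i j] .
    show "fst (snd (snd (W (0, j)))) = fst (snd (snd (W (0, j'))))" if "U (i, j) = U (i', j')" for i j i' j'
      using that const0[of i j] const0[of i' j'] unfolding W_def by metis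
  qed
qed

lemma int_chain_convergent:
  fixes a :: "int \<Rightarrow> nat \<Rightarrow> real"
  assumes "convergent (a 0)" and "\<And>j. convergent (a j) \<longleftrightarrow> convergent (a (j + 1))"
  shows "convergent (a j)"
  using shift_invariant_imp_const[of "\<lambda>j. convergent (a j)" j] assms by simp

lemma convergent_iff_of_diff_tendsto:
  fixes f g :: "nat \<Rightarrow> real"
  assumes "(\<lambda>n. g n - f n) \<longlonglongrightarrow> l"
  shows "convergent f \<longleftrightarrow> convergent g"
proof
  assume "convergent f"
  then have "convergent (\<lambda>n. f n + (g n - f n))"
    using assms by (intro convergent_add) (auto simp: convergent_def)
  then show "convergent g" by simp
next
  assume "convergent g"
  then have "convergent (\<lambda>n. g n - (g n - f n))"
    using assms by (rule convergent_diff[OF _ convergentI])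
  then show "convergent f" by simp
qed

text \<open>Along a subsequence for which the averages of one row converge, the averages of all rows
  converge, because the bounded carries make consecutive averages related by an invertible affine
  map up to \<open>O(1/n)\<close>. The limits are an exact orbit.\<close>

lemma beatty_tiling_orbit:
  fixes D C :: "int \<times> int \<Rightarrow> int \<times> int"
  assumes tile: "\<And>i j. beatty_tile M (e j) (label j) (k j) (D (i, j)) (D (i, j + 1)) (C (i, j)) (C (i + 1, j))"
  obtains X Y where "doubling_orbit X"
    and "\<forall>j. of_int (label j) \<le> Y j \<and> Y j \<le> of_int (label j) + 1"
    and "\<forall>j. Y (j + 1) = Y j + real (M * M) * X j - real M * of_int (k j)"
proof -
  define dx where "dx j i = real_of_int (fst (D (int i, j)))" for j and i :: nat
  define dy where "dy j i = real_of_int (snd (D (int i, j)))" for j and i :: nat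
  define cx where "cx j i = real_of_int (fst (C (int i, j)))" for j and i :: nat
  define cy where "cy j i = real_of_int (snd (C (int i, j)))" for j and i :: nat
  note defs = dx_def dy_def cx_def cy_def
  have tileN: "beatty_tile M (e j) (label j) (k j) (D (int i, j)) (D (int i, j + 1))
      (C (int i, j)) (C (int (Suc i), j))" for i j
    using tile[where i = "int i" and j = j] by (simp add: add.commute[of 1])
  note T = beatty_tileD[OF tileN, folded defs]
  have bounds: "1 \<le> dx j i" "dx j i \<le> 6" "0 \<le> dy j i" "dy j i \<le> real M" for i j
  proof -
    show "1 \<le> dx j i" "dx j i \<le> 6"
      using T(3)[of j i] T(4)[of j i] T(5)[of j i] T(6)[of j i] by (cases "e j"; simp)+
    \<comment> \<open>A tile bounds its northern digit in this way, so the tile in the row below is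
      used.\<close>
    show "0 \<le> dy j i" "dy j i \<le> real M"
      using T(8)[of "j - 1" i] T(9)[of "j - 1" i] by auto
  qed
  define A where "A j n = average (dx j) n" for j n
  define B where "B j n = average (dy j) n" for j n
  define c where "c j = (if e j then 2 else 1 / 3 :: real)" for j
  have limA: "(\<lambda>n. A (j + 1) n - c j * A j n) \<longlonglongrightarrow> 0" for j
  proof (cases "e j")
    case True
    have "(\<lambda>n. average (dx (j + 1)) n - average (\<lambda>i. 2 * dx j i) n) \<longlonglongrightarrow> 0"
      using T(1)[OF True] T(10) by (intro average_carry_tendsto[where c = "cx j"]) auto
    then show ?thesis using True by (simp add: A_def c_def average_cmult)
  next
    case False
    have "(\<lambda>n. average (\<lambda>i. 3 * dx (j + 1) i) n - average (dx j) n) \<longlonglongrightarrow> 0"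
      using T(2)[OF False] T(10) by (intro average_carry_tendsto[where c = "cx j"]) auto
    from tendsto_mult_left[OF this, of "1 / 3"] show ?thesis
      using False by (simp add: A_def c_def average_cmult algebra_simps)
  qed
  have limB: "(\<lambda>n. B (j + 1) n + real M * of_int (k j) - (B j n + real (M * M) * A j n)) \<longlonglongrightarrow> 0" for j
  proof -
    have "(\<lambda>n. average (\<lambda>i. dy (j + 1) i + real M * of_int (k j)) n
        - average (\<lambda>i. dy j i + real (M * M) * dx j i) n) \<longlonglongrightarrow> 0"
      using T(7) T(11) by (intro average_carry_tendsto[where c = "cy j"]) auto
    then show ?thesis
      by (simp only: average_add average_cmult average_const A_def B_def)
  qed
  have "\<forall>n. (A 0 n, B 0 n) \<in> {1..6} \<times> {0..real M}"
    using average_bounds[of 1 "dx 0" 6] average_bounds[of 0 "dy 0" "real M"] bounds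
    by (auto simp: A_def B_def)
  moreover have "compact ({1..6} \<times> {0..real M} :: (real \<times> real) set)"
    by (intro compact_Times compact_Icc)
  ultimately obtain l \<phi> where \<phi>: "strict_mono \<phi>"
    and l: "((\<lambda>n. (A 0 n, B 0 n)) \<circ> \<phi>) \<longlonglongrightarrow> l"
    unfolding compact_def by meson
  have conv0: "convergent (\<lambda>n. A 0 (\<phi> n))" "convergent (\<lambda>n. B 0 (\<phi> n))"
    using tendsto_fst[OF l] tendsto_snd[OF l] by (auto simp: convergent_def o_def)
  have limA': "(\<lambda>n. A (j + 1) (\<phi> n) - c j * A j (\<phi> n)) \<longlonglongrightarrow> 0" for j
    using LIMSEQ_subseq_LIMSEQ[OF limA \<phi>] by (simp add: o_def)
  have limB': "(\<lambda>n. B (j + 1) (\<phi> n) + real M * of_int (k j)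
      - (B j (\<phi> n) + real (M * M) * A j (\<phi> n))) \<longlonglongrightarrow> 0" for j
    using LIMSEQ_subseq_LIMSEQ[OF limB \<phi>] by (simp add: o_def)
  have convA: "convergent (\<lambda>n. A j (\<phi> n))" for j
  proof (rule int_chain_convergent[of "\<lambda>j n. A j (\<phi> n)", OF conv0(1)])
    fix j
    have "c j \<noteq> 0" by (simp add: c_def)
    then show "convergent (\<lambda>n. A j (\<phi> n)) \<longleftrightarrow> convergent (\<lambda>n. A (j + 1) (\<phi> n))"
      using convergent_iff_of_diff_tendsto[OF limA'[of j]] by (simp add: convergent_mult_const_iff)
  qed
  define X where "X j = lim (\<lambda>n. A j (\<phi> n))" for j
  have X: "(\<lambda>n. A j (\<phi> n)) \<longlonglongrightarrow> X j" for j
    unfolding X_def using convA convergent_LIMSEQ_iff by blast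
  have convB: "convergent (\<lambda>n. B j (\<phi> n))" for j
  proof (rule int_chain_convergent[of "\<lambda>j n. B j (\<phi> n)", OF conv0(2)])
    fix j
    have "(\<lambda>n. (B (j + 1) (\<phi> n) + real M * of_int (k j)
        - (B j (\<phi> n) + real (M * M) * A j (\<phi> n)))
        + (real (M * M) * A j (\<phi> n) - real M * of_int (k j)))
        \<longlonglongrightarrow> 0 + (real (M * M) * X j - real M * of_int (k j))"
      by (intro tendsto_intros limB' X)
    moreover have "(\<lambda>n. (B (j + 1) (\<phi> n) + real M * of_int (k j)
        - (B j (\<phi> n) + real (M * M) * A j (\<phi> n)))
        + (real (M * M) * A j (\<phi> n) - real M * of_int (k j)))
        = (\<lambda>n. B (j + 1) (\<phi> n) - B j (\<phi> n))" by auto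
    ultimately show "convergent (\<lambda>n. B j (\<phi> n)) \<longleftrightarrow> convergent (\<lambda>n. B (j + 1) (\<phi> n))"
      using convergent_iff_of_diff_tendsto by metis
  qed
  define Y where "Y j = lim (\<lambda>n. B j (\<phi> n))" for j
  have Y: "(\<lambda>n. B j (\<phi> n)) \<longlonglongrightarrow> Y j" for j
    unfolding Y_def using convB convergent_LIMSEQ_iff by blast
  have limit_bounds: "a \<le> z \<and> z \<le> b"
    if "(\<lambda>n. average f (\<phi> n)) \<longlonglongrightarrow> z" "\<And>i. a \<le> f i" "\<And>i. f i \<le> b" for f a b z
    using that average_bounds[of a f b]
    by (intro conjI LIMSEQ_le_const[OF that(1)] LIMSEQ_le_const2[OF that(1)]) auto
  show ?thesis
  proof (rule that; (intro allI)?)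
    have step: "X (j + 1) = c j * X j" for j
    proof -
      have "(\<lambda>n. A (j + 1) (\<phi> n) - c j * A j (\<phi> n)) \<longlonglongrightarrow> X (j + 1) - c j * X j"
        by (intro tendsto_intros X)
      from LIMSEQ_unique[OF this limA'] show ?thesis by simp
    qed
    show "doubling_orbit X"
      unfolding doubling_orbit_def
    proof
      fix j
      show "1 \<le> X j \<and> X j \<le> 3 \<and> X (j + 1) = 2 * X j \<or> 3 \<le> X j \<and> X j \<le> 6 \<and> X (j + 1) = X j / 3"
      proof (cases "e j")
        case True
        then have "1 \<le> X j \<and> X j \<le> 3"
          using T(3) by (intro limit_bounds[OF X[unfolded A_def]] bounds) auto
        then show ?thesis using step[of j] True by (simp add: c_def)
      next
        case False
        then have "3 \<le> X j \<and> X j \<le> 6"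
          using T(4) by (intro limit_bounds[OF X[unfolded A_def]] bounds) auto
        then show ?thesis using step[of j] False by (simp add: c_def)
      qed
    qed
    show "of_int (label j) \<le> Y j \<and> Y j \<le> of_int (label j) + 1" for j
      using T(12,13) by (intro limit_bounds[OF Y[unfolded B_def]]) auto
    show "Y (j + 1) = Y j + real (M * M) * X j - real M * of_int (k j)" for j
    proof -
      have "(\<lambda>n. B (j + 1) (\<phi> n) + real M * of_int (k j)
          - (B j (\<phi> n) + real (M * M) * A j (\<phi> n)))
          \<longlonglongrightarrow> Y (j + 1) + real M * of_int (k j) - (Y j + real (M * M) * X j)"
        by (intro tendsto_intros X Y)
      from LIMSEQ_unique[OF this limB'] show ?thesis by simp
    qed
  qed
qed

section \<open>Coincidences between rows of a tiling\<close>

lemma sum_of_differences: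
  fixes Y :: "int \<Rightarrow> real"
  shows "Y (i + int b) - Y i = (\<Sum>l<b. Y (i + int l + 1) - Y (i + int l))"
  by (induction b) (simp_all add: add_ac)

text \<open>Equal labels at vertical distance \<open>b\<close> put the two values of
  \<open>Y\<close> into the same unit interval. Their difference is \<open>M\<close> times the
  distance of \<open>M\<close> times an orbit sum from an integer, so this sum is counted by
  \<open>near_integer_sums_density\<close>. Arbitrary \<open>i\<close> and \<open>i'\<close> make
  the bound cover every horizontal component of a shift.\<close>

lemma equal_labels_density:
  assumes U: "tiling (beatty_tile_set M) U" and "M' > 0" and M: "M = 4 * M'" and "t \<noteq> 0"
  shows "\<exists>C. \<forall>n B. real (card {j \<in> window B n. \<exists>i i'. U (i, j) = U (i', j + t)})
    \<le> 102 / real M * real n + C"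
proof -
  obtain e label k and D C :: "int \<times> int \<Rightarrow> int \<times> int"
    where tile: "\<forall>i j. beatty_tile M (e j) (label j) (k j) (D (i, j)) (D (i, j + 1)) (C (i, j)) (C (i + 1, j))"
      and label: "\<forall>i j i' j'. U (i, j) = U (i', j') \<longrightarrow> label j = label j'"
    by (rule beatty_tiling_rows[OF U])
  obtain X Y where X: "doubling_orbit X"
    and Y: "\<forall>j. of_int (label j) \<le> Y j \<and> Y j \<le> of_int (label j) + 1"
      "\<forall>j. Y (j + 1) = Y j + real (M * M) * X j - real M * of_int (k j)"
    by (rule beatty_tiling_orbit[OF tile[rule_format]])
  define b where "b = nat \<bar>t\<bar>"
  have "b > 0" using \<open>t \<noteq> 0\<close> by (simp add: b_def)
  have "M > 0" using M \<open>M' > 0\<close> by simp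
  define P where "P i \<longleftrightarrow> (\<exists>Z::int. \<bar>real M * (\<Sum>l<b. X (i + int l)) - of_int Z\<bar> \<le> 1 / real M)" for i
  have P: "P j" if "label j = label (j + int b)" for j
  proof -
    define z where "z = real M * (\<Sum>l<b. X (j + int l)) - of_int (\<Sum>l<b. k (j + int l))"
    have "Y (j + int b) - Y j = (\<Sum>l<b. real (M * M) * X (j + int l) - real M * of_int (k (j + int l)))"
      unfolding sum_of_differences Y(2)[rule_format] by simp
    also have "\<dots> = real M * (real M * (\<Sum>l<b. X (j + int l)) - of_int (\<Sum>l<b. k (j + int l)))"
      by (simp add: sum_subtractf sum_distrib_left algebra_simps)
    finally have "\<bar>real M * z\<bar> \<le> 1"
      using Y(1)[rule_format, of j] Y(1)[rule_format, of "j + int b"] that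
      unfolding z_def by (simp add: abs_le_iff)
    then have "\<bar>z\<bar> \<le> 1 / real M" using \<open>M > 0\<close> by (simp add: abs_mult field_simps)
    then show ?thesis unfolding P_def z_def by blast
  qed
  obtain K where K: "\<And>n B. real (card {i \<in> window B n. P i}) \<le> 102 / real M * real n + K"
    using near_integer_sums_density[OF X \<open>M' > 0\<close> \<open>b > 0\<close> M] unfolding P_def by blast
  \<comment> \<open>For negative \<open>t\<close> the pair of rows is indexed by its lower member
    \<open>j + t\<close>, so the window moves by \<open>t\<close>.\<close>
  define s where "s = min t 0"
  have "card {j \<in> window B n. \<exists>i i'. U (i, j) = U (i', j + t)} \<le> card {i \<in> window (B + s) n. P i}" for n B
  proof -
    have "P (j + s)" if "U (i, j) = U (i', j + t)" for i i' j
    proof (rule P)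
      have "t = int b \<and> s = 0 \<or> t = - int b \<and> s = - int b" by (auto simp: b_def s_def)
      then show "label (j + s) = label (j + s + int b)" using label[rule_format, OF that] by auto
    qed
    then have "card {j \<in> window B n. \<exists>i i'. U (i, j) = U (i', j + t)} \<le> card {j \<in> window B n. P (j + s)}"
      by (intro card_mono) auto
    then show ?thesis by (simp only: card_window_shift[where P = P])
  qed
  then have "real (card {j \<in> window B n. \<exists>i i'. U (i, j) = U (i', j + t)}) \<le> 102 / real M * real n + K" for n B
    using K by (meson order_trans of_nat_mono)
  then show ?thesis by blast
qed

lemma square_eq_window: "square a b n = window a n \<times> window b n"
  by (simp add: square_def window_def)

text \<open>A coincidence under the shift puts its whole row among those counted by
  \<open>equal_labels_density\<close>, and each such row contributes at most \<open>n\<close>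
  coincidences. The slack \<gamma> absorbs the constant \<open>C\<close> once \<open>n\<close> is
  large.\<close>

lemma beatty_tiling_mismatches:
  assumes U: "tiling (beatty_tile_set M) U" and "M' > 0" and M: "M = 4 * M'"
    and \<alpha>: "\<alpha> + 102 / real M < 1" and T: "snd T \<noteq> 0"
  shows "\<exists>N. \<forall>n\<ge>N. \<forall>a b. real (card {x \<in> square a b n. U x \<noteq> U (x + T)}) > \<alpha> * real (card (square a b n))"
proof -
  obtain C where C: "\<And>n B. real (card {j \<in> window B n. \<exists>i i'. U (i, j) = U (i', j + snd T)})
    \<le> 102 / real M * real n + C"
    using equal_labels_density[OF U \<open>M' > 0\<close> M T] by blast
  define \<gamma> where "\<gamma> = 1 - \<alpha> - 102 / real M"
  have "\<gamma> > 0" using \<alpha> by (simp add: \<gamma>_def)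
  obtain N :: nat where N: "C / \<gamma> < real N" using reals_Archimedean2 by blast
  show ?thesis
  proof (intro exI[of _ "Suc N"] allI impI)
    fix n a b assume "Suc N \<le> n"
    then have n: "real n > 0" "C / \<gamma> < real n" using N by auto
    define eqs where "eqs = {x \<in> square a b n. U x = U (x + T)}"
    define J where "J = {j \<in> window b n. \<exists>i i'. U (i, j) = U (i', j + snd T)}"
    have fin: "finite (square a b n)" by (simp add: square_eq_window)
    have "eqs \<subseteq> window a n \<times> J"
      unfolding eqs_def J_def square_eq_window by (cases T) (clarsimp, blast)
    then have "card eqs \<le> card (window a n \<times> J)"
      by (intro card_mono) (auto simp: J_def)
    then have "card eqs \<le> n * card J" by (simp add: card_cartesian_product)
    then have "real (card eqs) \<le> real n * real (card J)" by (simp flip: of_nat_mult)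
    also have "\<dots> \<le> real n * (102 / real M * real n + C)"
      using C unfolding J_def by (intro mult_left_mono) auto
    also have "\<dots> < real n * ((1 - \<alpha>) * real n)"
    proof (rule mult_strict_left_mono)
      have "C < \<gamma> * real n" using n \<open>\<gamma> > 0\<close> by (simp add: field_simps)
      then show "102 / real M * real n + C < (1 - \<alpha>) * real n" by (simp add: \<gamma>_def algebra_simps)
    qed (use n in simp)
    finally have eqs: "real (card eqs) < (1 - \<alpha>) * real (card (square a b n))"
      by (simp add: square_eq_window card_cartesian_product algebra_simps)
    have "{x \<in> square a b n. U x \<noteq> U (x + T)} = square a b n - eqs" by (auto simp: eqs_def)
    then have "real (card {x \<in> square a b n. U x \<noteq> U (x + T)}) = real (card (square a b n)) - real (card eqs)"
      using fin by (simp add: eqs_def card_Diff_subset of_nat_diff card_mono)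
    then show "real (card {x \<in> square a b n. U x \<noteq> U (x + T)}) > \<alpha> * real (card (square a b n))"
      using eqs by (simp add: algebra_simps)
  qed
qed

subsection \<open>Existence of tilings\<close>

text \<open>The orbit is 6 to the power \<open>frac (i * \<theta>)\<close> with
  \<open>\<theta> = log 6 2\<close>: the rotation by \<theta> doubles the value, and on wrapping it
  divides by \<open>6 powr (1 - \<theta>) = 3\<close>.\<close>

lemma exists_doubling_orbit: "\<exists>X. doubling_orbit X"
proof -
  define \<theta> :: real where "\<theta> = log 6 2"
  have \<theta>: "0 < \<theta>" "\<theta> < 1" by (auto simp: \<theta>_def)
  have p2: "6 powr \<theta> = 2" by (simp add: \<theta>_def)
  have p3: "6 powr (1 - \<theta>) = 3" by (simp add: powr_diff p2)
  define u where "u i = frac (of_int i * \<theta>)" for i :: int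
  have "doubling_orbit (\<lambda>i. 6 powr u i)"
    unfolding doubling_orbit_def
  proof
    fix i
    have u: "0 \<le> u i" "u i < 1" by (auto simp: u_def frac_lt_1)
    have frac: "frac \<theta> = \<theta>" using \<theta> by (simp add: frac_eq)
    have step: "u (i + 1) = (if u i + \<theta> < 1 then u i + \<theta> else u i + \<theta> - 1)"
      using frac_add[of "of_int i * \<theta>" \<theta>] by (simp add: u_def frac algebra_simps)
    show "1 \<le> 6 powr u i \<and> 6 powr u i \<le> 3 \<and> 6 powr u (i + 1) = 2 * 6 powr u i \<or>
        3 \<le> 6 powr u i \<and> 6 powr u i \<le> 6 \<and> 6 powr u (i + 1) = 6 powr u i / 3"
    proof (cases "u i + \<theta> < 1")
      case True
      then have "6 powr u i \<le> 6 powr (1 - \<theta>)" by (intro powr_mono) auto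
      then show ?thesis using True step u p2 p3 by (simp add: powr_add ge_one_powr_ge_zero)
    next
      case False
      then have "6 powr (1 - \<theta>) \<le> 6 powr u i" "6 powr u i \<le> 6 powr 1"
        using u by (intro powr_mono; simp)+
      moreover have "u (i + 1) = u i - (1 - \<theta>)" using False step by simp
      then have "6 powr u (i + 1) = 6 powr u i / 3" by (simp only: powr_diff[of 6 "u i"] p3)
      ultimately show ?thesis by (simp add: p3)
    qed
  qed
  then show ?thesis by blast
qed

section \<open>Beatty digits and explicit carries\<close>

lemma exists_antidifference:
  fixes h :: "int \<Rightarrow> real"
  shows "\<exists>G. \<forall>i. G (i + 1) = G i + h i"
proof -
  define G where "G i = (if 0 \<le> i then sum h {0..<i} else - sum h {i..<0})" for i
  have "G (i + 1) = G i + h i" for i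
  proof (cases "0 \<le> i")
    case True
    then have "{0..<i + 1} = insert i {0..<i}" by auto
    then show ?thesis using True by (simp add: G_def)
  next
    case False
    then have "{i..<0} = insert i {i + 1..<0}" by auto
    then show ?thesis using False by (auto simp: G_def)
  qed
  then show ?thesis by blast
qed

text \<open>The difference sequence of the Beatty sequence of slope \<open>x\<close>: its partial
  sums are floors of multiples of \<open>x\<close>, so it averages to \<open>x\<close> with bounded
  error.\<close>

definition beatty :: "real \<Rightarrow> int \<Rightarrow> int" where
  "beatty x i = \<lfloor>of_int (i + 1) * x\<rfloor> - \<lfloor>of_int i * x\<rfloor>"

lemma beatty_bounds:
  assumes "of_int a \<le> x" "x \<le> of_int b"
  shows "a \<le> beatty x i" "beatty x i \<le> b"
  using assms unfolding beatty_def by (simp_all add: algebra_simps, linarith+)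

text \<open>Every row spells an orbit point in Beatty digits. Since these telescope to floors, the
  carries have closed forms as differences of floors and stay bounded.\<close>

lemma exists_beatty_tiling:
  assumes "M > 0"
  shows "\<exists>U. tiling (beatty_tile_set M) U"
proof -
  obtain X where X: "doubling_orbit X" using exists_doubling_orbit by blast
  obtain G where G: "\<And>j. G (j + 1) = G j + real M * X j"
    using exists_antidifference[of "\<lambda>j. real M * X j"] by blast
  \<comment> \<open>\<open>G\<close> is a lift of the \<open>y\<close> coordinate to the real line;
    \<open>k\<close> records the change of its integer part.\<close>
  define Y where "Y j = real M * frac (G j)" for j
  define k where "k j = \<lfloor>G (j + 1)\<rfloor> - \<lfloor>G j\<rfloor>" for j
  define label where "label j = \<lfloor>Y j\<rfloor>" for j
  \<comment> \<open>The condition on the successor matters at \<open>X j = 3\<close>, where the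
    orbit may take either branch.\<close>
  define e where "e j \<longleftrightarrow> X j \<le> 3 \<and> X (j + 1) = 2 * X j" for j
  have Xb: "1 \<le> X j" "X j \<le> 6" for j using doubling_orbit_bounds[OF X] by auto
  have Yb: "0 \<le> Y j" "Y j < real M" for j
    using \<open>M > 0\<close> frac_lt_1[of "G j"] by (auto simp: Y_def)
  have Ystep: "Y (j + 1) + real M * of_int (k j) = Y j + real (M * M) * X j" for j
    unfolding Y_def k_def frac_def G by (simp add: algebra_simps)
  have k: "0 \<le> k j" "k j \<le> 6 * int M + 1" for j
  proof -
    have MX: "0 \<le> real M * X j" "real M * X j \<le> real M * 6"
      using Xb[of j] by (auto intro!: mult_left_mono mult_nonneg_nonneg)
    show "0 \<le> k j" using MX unfolding k_def G by (simp add: floor_mono)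
    have "k j < 6 * int M + 2" using MX unfolding k_def G by linarith
    then show "k j \<le> 6 * int M + 1" by simp
  qed
  define D where "D i j = (beatty (X j) i, beatty (Y j) i)" for i j
  \<comment> \<open>The constants added here and in \<open>cy\<close> cancel between the two sides
    of a tile and make the carries nonnegative:
    \<open>2 * \<lfloor>t\<rfloor> - \<lfloor>2 * t\<rfloor>\<close> can be -1.\<close>
  define cx where "cx i j = (if e j then 2 * \<lfloor>of_int i * X j\<rfloor> - \<lfloor>of_int i * X (j + 1)\<rfloor> + 1
      else \<lfloor>of_int i * X j\<rfloor> - 3 * \<lfloor>of_int i * X (j + 1)\<rfloor>)" for i j
  define cy where "cy i j = (\<lfloor>of_int i * Y j\<rfloor> + int (M * M) * \<lfloor>of_int i * X j\<rfloor>)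
      - (\<lfloor>of_int i * Y (j + 1)\<rfloor> + int M * k j * i) + int (M * M) + 1" for i j
  have cx: "0 \<le> cx i j \<and> cx i j \<le> 3" for i j
  proof (cases "e j")
    case True
    then have "of_int i * X (j + 1) = 2 * (of_int i * X j)" by (simp add: e_def)
    then show ?thesis using True unfolding cx_def by (simp; linarith)
  next
    case False
    then have "X (j + 1) = X j / 3" using X unfolding e_def doubling_orbit_def by blast
    then have "of_int i * X j = 3 * (of_int i * X (j + 1))" by simp
    then show ?thesis using False unfolding cx_def by (simp; linarith)
  qed
  have cy: "0 \<le> cy i j \<and> cy i j \<le> int (M * M) + 1" for i j
  proof -
    define x y where "x = of_int i * X j" and "y = of_int i * Y j"
    have "of_int i * Y (j + 1) = y + real (M * M) * x - of_int (int M * k j * i)"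
      using arg_cong[OF Ystep[of j], of "\<lambda>z. of_int i * z"] by (simp add: x_def y_def algebra_simps)
    then have "\<lfloor>of_int i * Y (j + 1)\<rfloor> + int M * k j * i = \<lfloor>y + real (M * M) * x\<rfloor>"
      by (simp only: floor_diff_of_int)
    then have c: "cy i j = (\<lfloor>y\<rfloor> + int (M * M) * \<lfloor>x\<rfloor>) - \<lfloor>y + real (M * M) * x\<rfloor> + int (M * M) + 1"
      by (simp add: cy_def x_def y_def)
    have "real (M * M) * frac x \<le> real (M * M) * 1" "0 \<le> real (M * M) * frac x"
      using frac_lt_1[of x] by (intro mult_left_mono mult_nonneg_nonneg; simp)+
    moreover have "real (M * M) * x = real (M * M) * frac x + of_int (int (M * M) * \<lfloor>x\<rfloor>)"
      by (simp add: frac_def algebra_simps)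
    ultimately show ?thesis unfolding c by linarith
  qed
  have tile: "beatty_tile M (e j) (label j) (k j) (D i j) (D i (j + 1)) (cx i j, cy i j) (cx (i + 1) j, cy (i + 1) j)"
    for i j
  proof -
    have l: "0 \<le> label j" "label j < int M"
      using Yb[of j] by (auto simp: label_def floor_less_iff)
    have dy: "beatty (Y j) i \<in> {label j..label j + 1}"
      using beatty_bounds[of "label j" "Y j" "label j + 1" i] by (simp add: label_def)
    have dx': "beatty (X (j + 1)) i \<in> {1..6}"
      using beatty_bounds[of 1 "X (j + 1)" 6 i] Xb[of "j + 1"] by simp
    have dy': "beatty (Y (j + 1)) i \<in> {0..int M}"
      using beatty_bounds[of 0 "Y (j + 1)" "int M" i] Yb[of "j + 1"] by simp
    have dx: "if e j then beatty (X j) i \<in> {1..3} else beatty (X j) i \<in> {3..6}"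
    proof (cases "e j")
      case True
      then show ?thesis using beatty_bounds[of 1 "X j" 3 i] Xb[of j] by (simp add: e_def)
    next
      case False
      then have "3 \<le> X j" using X unfolding e_def doubling_orbit_def by blast
      then show ?thesis using beatty_bounds[of 3 "X j" 6 i] Xb[of j] False by simp
    qed
    show ?thesis
      unfolding beatty_tile_def D_def prod.case
      using l dy dx' dy' dx cx[of i j] cx[of "i + 1" j] cy[of i j] cy[of "i + 1" j] k[of j]
      by (auto simp: cx_def cy_def beatty_def algebra_simps)
  qed
  define U where "U = (\<lambda>(i, j). (to_nat (D i (j + 1)),
      to_nat ((cx (i + 1) j, cy (i + 1) j), e j, label j, k j), to_nat (D i j),
      to_nat ((cx i j, cy i j), e j, label j, k j)))"
  have "U (i, j) \<in> beatty_tile_set M" for i j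
    unfolding U_def prod.case beatty_tile_set_def using tile by blast
  then have "tiling (beatty_tile_set M) U"
    by (auto simp: tiling_def U_def north_def south_def east_def west_def)
  then show ?thesis by blast
qed

subsection \<open>Overlay with the transpose\<close>

definition transpose_tile :: "tile \<Rightarrow> tile" where
  "transpose_tile t = (east t, north t, west t, south t)"

definition overlay :: "tile \<Rightarrow> tile \<Rightarrow> tile" where
  "overlay s t = (prod_encode (north s, north t), prod_encode (east s, east t),
     prod_encode (south s, south t), prod_encode (west s, west t))"

lemmas side_defs = north_def east_def south_def west_def

lemma overlay_inject [simp]: "overlay s t = overlay s' t' \<longleftrightarrow> s = s' \<and> t = t'"
  by (cases s; cases t; cases s'; cases t') (auto simp: overlay_def side_defs prod_encode_eq)

lemma transpose_tile_inject [simp]: "transpose_tile s = transpose_tile t \<longleftrightarrow> s = t"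
  by (cases s; cases t) (auto simp: transpose_tile_def side_defs)

text \<open>Paired colours match exactly when both layers match. Transposing a tile exchanges the
  two matching directions, so the second layer is a tiling once its coordinates are swapped.\<close>

lemma tiling_overlay_transpose_iff:
  "tiling {overlay s (transpose_tile t) |s t. s \<in> \<tau> \<and> t \<in> \<tau>'} U \<longleftrightarrow>
   (\<exists>V W. tiling \<tau> V \<and> tiling \<tau>' W \<and> U = (\<lambda>(i, j). overlay (V (i, j)) (transpose_tile (W (j, i)))))"
  (is "?L \<longleftrightarrow> ?R")
proof
  assume ?L
  then have "\<forall>i j. \<exists>s t. s \<in> \<tau> \<and> t \<in> \<tau>' \<and> U (i, j) = overlay s (transpose_tile t)"
    unfolding tiling_def by blast
  then obtain V W where VW: "\<And>i j. V i j \<in> \<tau>" "\<And>i j. W i j \<in> \<tau>'"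
    "\<And>i j. U (i, j) = overlay (V i j) (transpose_tile (W i j))" by metis
  have "east (U (i, j)) = west (U (i + 1, j))" "north (U (i, j)) = south (U (i, j + 1))" for i j
    using \<open>?L\<close> unfolding tiling_def by auto
  then have "tiling \<tau> (\<lambda>(i, j). V i j)" "tiling \<tau>' (\<lambda>(j, i). W i j)"
    using VW(1,2) unfolding tiling_def VW(3)
    by (auto simp: overlay_def transpose_tile_def side_defs prod_encode_eq)
  then show ?R using VW(3)
    by (intro exI[of _ "\<lambda>(i, j). V i j"] exI[of _ "\<lambda>(j, i). W i j"]) auto
next
  assume ?R
  then obtain V W where V: "tiling \<tau> V" and W: "tiling \<tau>' W"
    and U: "U = (\<lambda>(i, j). overlay (V (i, j)) (transpose_tile (W (j, i))))" by blast
  have "U x \<in> {overlay s (transpose_tile t) |s t. s \<in> \<tau> \<and> t \<in> \<tau>'}" for x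
    using V W unfolding U tiling_def by (cases x) (auto simp del: split_paired_Ex)
  then show ?L
    using V W unfolding tiling_def by (simp add: U overlay_def transpose_tile_def side_defs)
qed

lemma card_square_swap:
  "card {x \<in> square a b n. P (prod.swap x)} = card {x \<in> square b a n. P x}"
  by (rule bij_betw_same_card[of prod.swap], rule bij_betwI[of _ _ _ prod.swap])
    (auto simp: square_def)

text \<open>A mismatch in either layer is a mismatch of the overlay. The first layer handles shifts
  with a vertical component, the transposed layer those with a horizontal one.\<close>

lemma aperiodic_overlay_transpose:
  assumes V: "\<And>T. snd T \<noteq> 0 \<Longrightarrow> \<exists>N. \<forall>n\<ge>N. \<forall>a b.
        real (card {x \<in> square a b n. V x \<noteq> V (x + T)}) > \<alpha> * real (card (square a b n))"
    and W: "\<And>T. snd T \<noteq> 0 \<Longrightarrow> \<exists>N. \<forall>n\<ge>N. \<forall>a b.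
        real (card {x \<in> square a b n. W x \<noteq> W (x + T)}) > \<alpha> * real (card (square a b n))"
  shows "aperiodic \<alpha> (\<lambda>(i, j). overlay (V (i, j)) (transpose_tile (W (j, i))))"
  unfolding aperiodic_def
proof (intro allI impI)
  let ?U = "\<lambda>(i, j). overlay (V (i, j)) (transpose_tile (W (j, i)))"
  fix T :: "int \<times> int" assume "T \<noteq> (0, 0)"
  have fin: "finite (square a b n)" for a b n by (simp add: square_def)
  consider "snd T \<noteq> 0" | "snd (prod.swap T) \<noteq> 0" using \<open>T \<noteq> (0, 0)\<close> by (cases T) auto
  then show "\<exists>N. \<forall>n\<ge>N. \<forall>a b.
      real (card {x \<in> square a b n. ?U x \<noteq> ?U (x + T)}) > \<alpha> * real (card (square a b n))"
  proof cases
    case 1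
    have "card {x \<in> square a b n. V x \<noteq> V (x + T)} \<le> card {x \<in> square a b n. ?U x \<noteq> ?U (x + T)}" for a b n
      using fin by (intro card_mono) (auto split: prod.splits)
    then show ?thesis using V[OF 1] by (meson less_le_trans of_nat_mono)
  next
    case 2
    define S where "S = prod.swap T"
    have "card {x \<in> square b a n. W x \<noteq> W (x + S)} \<le> card {x \<in> square a b n. ?U x \<noteq> ?U (x + T)}" for a b n
      unfolding card_square_swap[symmetric, of b a]
      using fin by (intro card_mono; cases T) (auto simp: S_def split: prod.splits)
    then have le: "real (card {x \<in> square b a n. W x \<noteq> W (x + S)})
        \<le> real (card {x \<in> square a b n. ?U x \<noteq> ?U (x + T)})" for a b n
      by (rule of_nat_mono)
    have size: "card (square b a n) = card (square a b n)" for a b n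
      by (simp add: square_def card_cartesian_product)
    obtain N where N: "\<And>n a b. n \<ge> N \<Longrightarrow>
        real (card {x \<in> square b a n. W x \<noteq> W (x + S)}) > \<alpha> * real (card (square b a n))"
      using W[OF 2, folded S_def] by blast
    show ?thesis
      using less_le_trans[OF N le] unfolding size by blast
  qed
qed

theorem mainTheorem9:
  fixes \<alpha> :: real
  assumes "\<alpha> < 1"
  shows "\<exists>\<tau>. tile_set \<tau> \<and> (\<exists>U. tiling \<tau> U) \<and> (\<forall>U. tiling \<tau> U \<longrightarrow> aperiodic \<alpha> U)"
proof -
  \<comment> \<open>Since \<open>4 * M'\<close> is at least \<open>M'\<close>, this makes the
    coincidence density \<open>102 / M\<close> smaller than \<open>1 - \<alpha>\<close>.\<close>
  obtain M' :: nat where M': "102 / (1 - \<alpha>) < real M'" using reals_Archimedean2 by blast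
  have "0 < 102 / (1 - \<alpha>)" using assms by simp
  then have "M' > 0" using M' by linarith
  define M where "M = 4 * M'"
  have "M > 0" "102 / (1 - \<alpha>) < real M" using M' \<open>M' > 0\<close> by (auto simp: M_def)
  then have \<alpha>: "\<alpha> + 102 / real M < 1" using assms by (simp add: field_simps)
  define \<tau> where "\<tau> = {overlay s (transpose_tile t) |s t. s \<in> beatty_tile_set M \<and> t \<in> beatty_tile_set M}"
  have "\<tau> = (\<lambda>(s, t). overlay s (transpose_tile t)) ` (beatty_tile_set M \<times> beatty_tile_set M)"
    unfolding \<tau>_def by auto
  then have "tile_set \<tau>" by (simp add: tile_set_def finite_beatty_tile_set)
  moreover have "\<exists>U. tiling \<tau> U"
    using exists_beatty_tiling[OF \<open>M > 0\<close>] unfolding \<tau>_def tiling_overlay_transpose_iff by blast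
  moreover have "aperiodic \<alpha> U" if "tiling \<tau> U" for U
  proof -
    obtain V W where "tiling (beatty_tile_set M) V" "tiling (beatty_tile_set M) W"
      and U: "U = (\<lambda>(i, j). overlay (V (i, j)) (transpose_tile (W (j, i))))"
      using \<open>tiling \<tau> U\<close> unfolding \<tau>_def tiling_overlay_transpose_iff by blast
    then show ?thesis
      unfolding U
      by (intro aperiodic_overlay_transpose beatty_tiling_mismatches[OF _ \<open>M' > 0\<close> M_def \<alpha>])
  qed
  ultimately show ?thesis by blast
qed

end
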